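(* Let $p$ be a prime and let $n$ be an integer larger than $1$. Then $\rho({C_p}^n) = 1+p^{\left\lceil n/2 \right\rceil}$.
   Context: ${C_p}^n$ denotes the elementary abelian $p$-group of rank $n$ (the direct product of $n$ copies of the cyclic group of order $p$). For a real number $x$, $\lceil x\rceil$ is the smallest integer $k$ with $k\geq x$. A cover of a finite group $G$ is a family of proper subgroups of $G$ whose union is $G$. A partition of $G$ is a cover $\{H_1,\ldots,H_m\}$ of $G$ such that $H_i\cap H_j=\{1\}$ whenever $i\neq j$. A group is partitionable if it admits a partition, and then $\rho(G)$ denotes the minimal size of a partition of $G$. (The group ${C_p}^n$ with $n>1$ is partitionable.) *)

theory Defs
  imports Complex_Main "HOL-Algebra.Product_Groups" "HOL-Computational_Algebra.Primes"
begin

definition group_cover :: "('a, 'b) monoid_scheme \<Rightarrow> 'a set set \<Rightarrow> bool"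
  where "group_cover G \<H> \<longleftrightarrow>
    (\<forall>H\<in>\<H>. subgroup H G \<and> H \<noteq> carrier G) \<and> \<Union>\<H> = carrier G"

definition group_partition :: "('a, 'b) monoid_scheme \<Rightarrow> 'a set set \<Rightarrow> bool"
  where "group_partition G \<H> \<longleftrightarrow>
    finite \<H> \<and> group_cover G \<H> \<and>
    (\<forall>H\<in>\<H>. \<forall>K\<in>\<H>. H \<noteq> K \<longrightarrow> H \<inter> K = {\<one>\<^bsub>G\<^esub>})"

definition partitionable :: "('a, 'b) monoid_scheme \<Rightarrow> bool"
  where "partitionable G \<longleftrightarrow> (\<exists>\<H>. group_partition G \<H>)"

(* Infimum in nat: the minimum when G is partitionable, and 0 otherwise. *)
definition rho :: "('a, 'b) monoid_scheme \<Rightarrow> nat"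
  where "rho G = Inf {card \<H> |\<H>. group_partition G \<H>}"

definition elementary_abelian_group :: "nat \<Rightarrow> nat \<Rightarrow> (nat \<Rightarrow> int) monoid"
  where "elementary_abelian_group p n = product_group {..<n} (\<lambda>_. integer_mod_group p)"

end

theory Submission
  imports Defs "HOL-Algebra.Algebraic_Closure" "HOL-Number_Theory.Residues"
begin

text \<open>
  Lower bound: in a partition of a group of order \<open>p ^ n\<close>, let \<open>H\<close> be a member of maximal order
  \<open>p ^ d\<close>. Trivial intersections force every other member to have order at most
  \<open>p ^ min d (n - d)\<close>, and counting the elements outside \<open>H\<close> shows that at least
  \<open>p ^ max d (n - d)\<close> further members are needed.

  Upper bound: let \<open>K\<close> be the field with \<open>q = p ^ m\<close> elements, \<open>m = \<lceil>n / 2\<rceil>\<close>. The \<open>q + 1\<close>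
  lines through the origin partition the additive group of \<open>K \<times> K\<close>, which has order
  \<open>p ^ (2 * m) \<ge> p ^ n\<close> and therefore contains a copy of the given group; intersecting the lines with
  that copy gives a partition, the parts being proper because \<open>m < n\<close>.
\<close>

(* Without this, the divisibility-theoretic constant of HOL-Algebra captures the name. *)
hide_const (open) Divisibility.prime

section \<open>Lower bound by counting elements\<close>

text \<open>The product map on pairs is injective: \<open>h \<otimes> k = h' \<otimes> k'\<close>
  puts \<open>inv h' \<otimes> h = k' \<otimes> inv k\<close> into the intersection.\<close>

lemma (in group) card_mult_le_of_trivial_inter:
  assumes "subgroup H G" "subgroup K G" "H \<inter> K = {\<one>}" "finite (carrier G)"
  shows "card H * card K \<le> order G"
proof -
  have HK: "H \<subseteq> carrier G" "K \<subseteq> carrier G"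
    using assms(1,2) subgroup.subset by blast+
  have "inj_on (\<lambda>(h, k). h \<otimes> k) (H \<times> K)"
  proof (rule inj_onI, clarsimp)
    fix h k h' k'
    assume a: "h \<in> H" "k \<in> K" "h' \<in> H" "k' \<in> K" "h \<otimes> k = h' \<otimes> k'"
    then have c: "h \<in> carrier G" "k \<in> carrier G" "h' \<in> carrier G" "k' \<in> carrier G"
      using HK by auto
    have "inv h' \<otimes> h = inv h' \<otimes> (h \<otimes> k) \<otimes> inv k"
      using c by (simp add: m_assoc)
    also have "\<dots> = inv h' \<otimes> (h' \<otimes> k') \<otimes> inv k"
      by (simp only: a(5))
    also have "\<dots> = k' \<otimes> inv k"
      using c by (simp add: m_assoc [symmetric])
    finally have e: "inv h' \<otimes> h = k' \<otimes> inv k" .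
    have "inv h' \<otimes> h \<in> H" "k' \<otimes> inv k \<in> K"
      using a assms(1,2) by (simp_all add: subgroup.m_closed subgroup.m_inv_closed)
    then have "inv h' \<otimes> h = \<one>" "k' \<otimes> inv k = \<one>"
      using e assms(3) by auto
    then show "h = h' \<and> k = k'"
      using c by (metis inv_equality inv_inv inv_closed l_inv r_inv)
  qed
  then have "card H * card K = card ((\<lambda>(h, k). h \<otimes> k) ` (H \<times> K))"
    by (simp add: card_image card_cartesian_product)
  also have "\<dots> \<le> order G"
    unfolding order_def using HK assms(4) by (intro card_mono) auto
  finally show ?thesis .
qed

lemma (in group) group_partition_card_ge:
  assumes part: "group_partition G \<H>" and ord: "order G = p ^ n" and p: "prime p" and n: "n > 0"
  shows "1 + p ^ ((n + 1) div 2) \<le> card \<H>"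
proof -
  define k where "k = (n + 1) div 2"
  have p1: "p > 1" using p by (rule prime_gt_1_nat)
  \<comment> \<open>\<open>card\<close> of an infinite set is 0, whereas a power of \<open>p\<close>
    is positive.\<close>
  have fin: "finite (carrier G)"
    using ord p1 unfolding order_def by (metis card.infinite not_one_less_zero power_eq_0_iff)
  have finH: "finite \<H>" and sub: "\<And>H. H \<in> \<H> \<Longrightarrow> subgroup H G"
    and proper: "\<And>H. H \<in> \<H> \<Longrightarrow> H \<noteq> carrier G" and un: "\<Union>\<H> = carrier G"
    and triv: "\<And>H K. H \<in> \<H> \<Longrightarrow> K \<in> \<H> \<Longrightarrow> H \<noteq> K \<Longrightarrow> H \<inter> K = {\<one>}"
    using part unfolding group_partition_def group_cover_def by auto
  have ne: "\<H> \<noteq> {}" using un one_closed by auto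
  have "Max (card ` \<H>) \<in> card ` \<H>" using finH ne by simp
  then obtain H where H: "H \<in> \<H>" and "card H = Max (card ` \<H>)" by auto
  then have maxH: "\<And>K. K \<in> \<H> \<Longrightarrow> card K \<le> card H" using finH by simp
  have finsub: "finite K" if "K \<in> \<H>" for K
    using finite_subset[OF _ fin, of K] un that by blast
  have "card H dvd p ^ n"
    using lagrange[OF sub[OF H]] ord by (metis dvd_triv_right)
  then obtain d where d: "card H = p ^ d" using p by (auto simp: divides_primepow_nat)
  have "card H < p ^ n"
    using psubset_card_mono[OF fin, of H] sub[OF H] proper[OF H] ord subgroup.subset
    unfolding order_def by fastforce
  then have dn: "d < n" using d p1 by simp
  \<comment> \<open>The members other than \<open>H\<close>, stripped of the identity, cover the
    complement of \<open>H\<close>. The bound \<open>b\<close> on their orders stays a parameter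
    because the two cases below supply different ones.\<close>
  have count: "p ^ n - p ^ d \<le> (card \<H> - 1) * (b - 1)"
    if b: "\<And>K. K \<in> \<H> - {H} \<Longrightarrow> card K \<le> b" for b
  proof -
    have "p ^ n - p ^ d = card (carrier G - H)"
      using card_Diff_subset[of H "carrier G"] finsub[OF H] sub[OF H] subgroup.subset d ord
      unfolding order_def by metis
    also have "\<dots> \<le> card (\<Union>K\<in>\<H> - {H}. K - {\<one>})"
    proof (rule card_mono)
      show "finite (\<Union>K\<in>\<H> - {H}. K - {\<one>})" using finH finsub by auto
      have "\<one> \<in> H" using sub[OF H] by (rule subgroup.one_closed)
      then show "carrier G - H \<subseteq> (\<Union>K\<in>\<H> - {H}. K - {\<one>})" using un by auto
    qed
    also have "\<dots> \<le> (\<Sum>K\<in>\<H> - {H}. card (K - {\<one>}))"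
      using finH by (intro card_UN_le) auto
    also have "\<dots> \<le> (\<Sum>K\<in>\<H> - {H}. b - 1)"
    proof (rule sum_mono)
      fix K assume K: "K \<in> \<H> - {H}"
      then have "\<one> \<in> K" using sub subgroup.one_closed by blast
      then show "card (K - {\<one>}) \<le> b - 1" using b[OF K] by (simp add: diff_le_mono)
    qed
    also have "\<dots> = (card \<H> - 1) * (b - 1)" using H finH by simp
    finally show ?thesis .
  qed
  \<comment> \<open>For large \<open>d\<close> the trivial intersection with \<open>H\<close> bounds
    the other members by \<open>p ^ (n - d)\<close>; for small \<open>d\<close> the maximality of
    \<open>H\<close> bounds them by \<open>p ^ d\<close>.\<close>
  have "p ^ k \<le> card \<H> - 1"
  proof (cases "k \<le> d")
    case True
    have "card K \<le> p ^ (n - d)" if "K \<in> \<H> - {H}" for K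
    proof -
      have "card H * card K \<le> p ^ n"
        using card_mult_le_of_trivial_inter[of H K] that H sub triv fin ord by auto
      also have "\<dots> = p ^ d * p ^ (n - d)" using dn by (simp flip: power_add)
      finally show ?thesis using d p1 by simp
    qed
    from count[OF this] have "p ^ n - p ^ d \<le> (card \<H> - 1) * (p ^ (n - d) - 1)" .
    moreover have "p ^ n - p ^ d = p ^ d * (p ^ (n - d) - 1)"
      using dn by (simp add: diff_mult_distrib2 flip: power_add)
    moreover have "p ^ (n - d) - 1 > 0" using one_less_power[OF p1, of "n - d"] dn by simp
    ultimately have "p ^ d \<le> card \<H> - 1" by simp
    then show ?thesis using True p1 by (meson le_trans less_imp_le power_increasing)
  next
    case False
    \<comment> \<open>From \<open>d < k\<close> and \<open>2 * k \<le> n + 1\<close> follows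
      \<open>k + d \<le> 2 * k - 1 \<le> n\<close>.\<close>
    have kd: "k + d \<le> n" using False unfolding k_def by linarith
    have c: "p ^ n - p ^ d \<le> (card \<H> - 1) * (p ^ d - 1)"
      using count maxH d by auto
    have "p ^ d < p ^ n" using dn p1 by simp
    \<comment> \<open>If the largest member were trivial, the count would bound a positive number by
      0.\<close>
    then have "p ^ d - 1 > 0" using c by (metis gr0I mult_0_right not_le zero_less_diff)
    \<comment> \<open>The left side is \<open>p ^ (k + d) - p ^ k\<close>, where
      \<open>k + d \<le> n\<close> and \<open>d < k\<close>.\<close>
    moreover have "p ^ k * (p ^ d - 1) \<le> p ^ n - p ^ d"
    proof -
      have "p ^ (k + d) \<le> p ^ n" "p ^ d \<le> p ^ k"
        using kd False p1 by (auto intro: power_increasing)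
      then show ?thesis by (simp add: diff_mult_distrib2 power_add)
    qed
    ultimately show ?thesis using c by (meson le_trans mult_le_cancel2)
  qed
  moreover have "card \<H> > 0" using finH ne by (simp add: card_gt_0_iff)
  ultimately show ?thesis unfolding k_def by linarith
qed

section \<open>Pulling partitions back along an embedding\<close>

text \<open>A member with fewer elements than \<open>G\<close> cannot contain the image of the
  embedding \<open>h\<close>; this is what makes the preimages proper. Preimages of different
  members may coincide, so the partition obtained can have fewer members than
  \<open>\<S>\<close>.\<close>

lemma group_partition_vimage:
  assumes G: "group G" and A: "group A" and h: "h \<in> hom G A" and inj: "inj_on h (carrier G)"
    and fin: "finite \<S>" and sub: "\<And>S. S \<in> \<S> \<Longrightarrow> subgroup S A"
    and card: "\<And>S. S \<in> \<S> \<Longrightarrow> finite S \<and> card S < order G"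
    and un: "\<Union>\<S> = carrier A"
    and triv: "\<And>S T. S \<in> \<S> \<Longrightarrow> T \<in> \<S> \<Longrightarrow> S \<noteq> T \<Longrightarrow> S \<inter> T = {\<one>\<^bsub>A\<^esub>}"
  shows "group_partition G ((\<lambda>S. h -` S \<inter> carrier G) ` \<S>)"
proof -
  interpret group_hom G A h
    using G A h by (simp add: group_hom_def group_hom_axioms_def)
  have psub: "subgroup (h -` S \<inter> carrier G) G" if "S \<in> \<S>" for S
    using sub[OF that]
    by (auto intro!: subgroup.intro simp: subgroup.m_closed subgroup.m_inv_closed subgroup.one_closed)
  have pne: "h -` S \<inter> carrier G \<noteq> carrier G" if "S \<in> \<S>" for S
  proof
    assume "h -` S \<inter> carrier G = carrier G"
    then have "h ` carrier G \<subseteq> S" by auto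
    then have "order G \<le> card S"
      unfolding order_def using card_inj_on_le[OF inj] card[OF that] by blast
    then show False using card[OF that] by auto
  qed
  have pun: "(\<Union>S\<in>\<S>. h -` S \<inter> carrier G) = carrier G"
  proof -
    have "(\<Union>S\<in>\<S>. h -` S \<inter> carrier G) = h -` \<Union>\<S> \<inter> carrier G" by blast
    also have "\<dots> = carrier G" unfolding un using hom_closed by auto
    finally show ?thesis .
  qed
  have ptriv: "(h -` S \<inter> carrier G) \<inter> (h -` T \<inter> carrier G) = {\<one>\<^bsub>G\<^esub>}"
    if "S \<in> \<S>" "T \<in> \<S>" "S \<noteq> T" for S T
  proof -
    have "x = \<one>\<^bsub>G\<^esub>" if x: "x \<in> carrier G" "h x \<in> S \<inter> T" for x
      using x triv[OF \<open>S \<in> \<S>\<close> \<open>T \<in> \<S>\<close> \<open>S \<noteq> T\<close>] inj hom_one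
      by (metis G.one_closed inj_onD singletonD)
    then show ?thesis
      using sub[OF \<open>S \<in> \<S>\<close>] sub[OF \<open>T \<in> \<S>\<close>] by (auto simp: subgroup.one_closed)
  qed
  show ?thesis
    unfolding group_partition_def group_cover_def
  proof (intro conjI)
    show "finite ((\<lambda>S. h -` S \<inter> carrier G) ` \<S>)" using fin by simp
    show "\<forall>H\<in>(\<lambda>S. h -` S \<inter> carrier G) ` \<S>. subgroup H G \<and> H \<noteq> carrier G"
      using psub pne by simp
    show "\<Union> ((\<lambda>S. h -` S \<inter> carrier G) ` \<S>) = carrier G"
      by (rule pun)
    show "\<forall>H\<in>(\<lambda>S. h -` S \<inter> carrier G) ` \<S>. \<forall>K\<in>(\<lambda>S. h -` S \<inter> carrier G) ` \<S>.
        H \<noteq> K \<longrightarrow> H \<inter> K = {\<one>\<^bsub>G\<^esub>}"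
    proof (clarsimp simp only: ball_simps)
      fix S T assume "S \<in> \<S>" "T \<in> \<S>" "h -` S \<inter> carrier G \<noteq> h -` T \<inter> carrier G"
      then show "h -` S \<inter> carrier G \<inter> (h -` T \<inter> carrier G) = {\<one>\<^bsub>G\<^esub>}"
        using ptriv[of S T] by fastforce
    qed
  qed
qed

section \<open>Frobenius and the field with \<open>p ^ m\<close> elements\<close>

lemma (in cring) binomial:
  fixes n :: nat
  assumes a: "a \<in> carrier R" and b: "b \<in> carrier R"
  shows "(a \<oplus> b) [^] n = (\<Oplus>k\<in>{..n}. [(n choose k)] \<cdot> (a [^] k \<otimes> b [^] (n - k)))"
proof (induction n)
  case 0
  show ?case using a b by (simp add: Pi_def)
next
  case (Suc n)
  \<comment> \<open>The monomials of degree \<open>Suc n\<close>: multiplication by \<open>a\<close>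
    turns the \<open>k\<close>-th term of the old sum into \<open>t (Suc k)\<close>, multiplication
    by \<open>b\<close> into \<open>t k\<close>.\<close>
  define t where "t k = a [^] k \<otimes> b [^] (Suc n - k)" for k :: nat
  have t: "t k \<in> carrier R" for k using a b unfolding t_def by simp
  have "a \<otimes> (\<Oplus>k\<in>{..n}. [(n choose k)] \<cdot> (a [^] k \<otimes> b [^] (n - k)))
      = (\<Oplus>k\<in>{..n}. a \<otimes> [(n choose k)] \<cdot> (a [^] k \<otimes> b [^] (n - k)))"
    using a b by (intro finsum_rdistr) auto
  also have "\<dots> = (\<Oplus>k\<in>{..n}. [(n choose k)] \<cdot> t (Suc k))"
    using a b t by (intro add.finprod_cong')
      (auto simp: t_def add_pow_rdistr m_ac)
  finally have A: "a \<otimes> (\<Oplus>k\<in>{..n}. [(n choose k)] \<cdot> (a [^] k \<otimes> b [^] (n - k))) = \<dots>" .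
  have "b \<otimes> (\<Oplus>k\<in>{..n}. [(n choose k)] \<cdot> (a [^] k \<otimes> b [^] (n - k)))
      = (\<Oplus>k\<in>{..n}. b \<otimes> [(n choose k)] \<cdot> (a [^] k \<otimes> b [^] (n - k)))"
    using a b by (intro finsum_rdistr) auto
  also have "\<dots> = (\<Oplus>k\<in>{..n}. [(n choose k)] \<cdot> t k)"
    using a b t by (intro add.finprod_cong')
      (auto simp: t_def add_pow_rdistr Suc_diff_le m_ac)
  \<comment> \<open>The added term has coefficient \<open>n choose Suc n = 0\<close>. Once
    \<open>t 0\<close> is split off, both sums run over the same \<open>t (Suc k)\<close> and
    Pascal's rule applies termwise.\<close>
  also have "\<dots> = (\<Oplus>k\<in>{..Suc n}. [(n choose k)] \<cdot> t k)"
    using t by (subst finsum_Suc) (auto intro!: add.nat_pow_closed finsum_closed simp: binomial_eq_0)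
  also have "\<dots> = (\<Oplus>k\<in>{..n}. [(n choose Suc k)] \<cdot> t (Suc k)) \<oplus> t 0"
    using t by (subst finsum_Suc2) auto
  finally have B: "b \<otimes> (\<Oplus>k\<in>{..n}. [(n choose k)] \<cdot> (a [^] k \<otimes> b [^] (n - k))) = \<dots>" .
  have "(a \<oplus> b) [^] Suc n = (\<Oplus>k\<in>{..n}. [(n choose k)] \<cdot> (a [^] k \<otimes> b [^] (n - k))) \<otimes> (a \<oplus> b)"
    using Suc by simp
  also have "\<dots> = a \<otimes> (\<Oplus>k\<in>{..n}. [(n choose k)] \<cdot> (a [^] k \<otimes> b [^] (n - k)))
      \<oplus> b \<otimes> (\<Oplus>k\<in>{..n}. [(n choose k)] \<cdot> (a [^] k \<otimes> b [^] (n - k)))"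
    using a b by (subst m_comm) (auto intro!: finsum_closed l_distr)
  also have "\<dots> = (\<Oplus>k\<in>{..n}. [(n choose k)] \<cdot> t (Suc k)) \<oplus> (\<Oplus>k\<in>{..n}. [(n choose Suc k)] \<cdot> t (Suc k)) \<oplus> t 0"
    unfolding A B using t by (subst a_assoc) (auto intro!: finsum_closed)
  also have "\<dots> = (\<Oplus>k\<in>{..n}. [(Suc n choose Suc k)] \<cdot> t (Suc k)) \<oplus> t 0"
    using t by (subst finsum_addf [symmetric]) (auto simp: add.nat_pow_mult)
  also have "\<dots> = (\<Oplus>k\<in>{..Suc n}. [(Suc n choose k)] \<cdot> t k)"
    using t by (subst finsum_Suc2) auto
  finally show ?case unfolding t_def .
qed

lemma (in ring) add_pow_char_eq_zero:
  fixes p c :: nat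
  assumes char: "[p] \<cdot> \<one> = \<zero>" and x: "x \<in> carrier R" and dvd: "p dvd c"
  shows "[c] \<cdot> x = \<zero>"
proof -
  obtain d where c: "c = p * d" using dvd by auto
  have "[p] \<cdot> x = \<zero>"
    using add_pow_ldistr[of \<one> x p] x char by simp
  then show ?thesis
    unfolding c using x by (simp add: add.nat_pow_pow [symmetric])
qed

text \<open>The exponent \<open>p\<close> is the core: the inner binomial coefficients are divisible
  by \<open>p\<close> and hence act as zero. Powers of \<open>p\<close> follow by iteration.\<close>

lemma (in cring) frobenius_add:
  fixes p k :: nat
  assumes p: "prime p" and char: "[p] \<cdot> \<one> = \<zero>" and a: "a \<in> carrier R" and b: "b \<in> carrier R"
  shows "(a \<oplus> b) [^] (p ^ k) = a [^] (p ^ k) \<oplus> b [^] (p ^ k)"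
proof (induction k)
  case 0
  show ?case using a b by simp
next
  case (Suc k)
  have step: "(x \<oplus> y) [^] p = x [^] p \<oplus> y [^] p" if x: "x \<in> carrier R" and y: "y \<in> carrier R" for x y
  proof -
    \<comment> \<open>Writing \<open>p\<close> as \<open>l + 2\<close> lets both end terms be split
      off the binomial sum, leaving the indices from 1 to \<open>l + 1\<close>.\<close>
    obtain l where l: "p = Suc (Suc l)"
      using prime_ge_2_nat[OF p] that[of "p - 2"] by simp
    define f where "f i = [(p choose i)] \<cdot> (x [^] i \<otimes> y [^] (p - i))" for i :: nat
    have f: "f i \<in> carrier R" for i using x y unfolding f_def by simp
    have "f (Suc i) = \<zero>" if "i \<le> l" for i
      unfolding f_def using x y that l p
      by (intro add_pow_char_eq_zero[OF char] dvd_choose_prime) auto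
    then have mid: "(\<Oplus>i\<in>{..l}. f (Suc i)) = \<zero>"
      by (intro add.finprod_one_eqI) auto
    have "(x \<oplus> y) [^] p = (\<Oplus>i\<in>{..Suc (Suc l)}. f i)"
      using binomial[OF x y, of p] unfolding f_def l .
    also have "\<dots> = f p \<oplus> ((\<Oplus>i\<in>{..l}. f (Suc i)) \<oplus> f 0)"
      using f by (subst finsum_Suc, simp, subst finsum_Suc2) (auto simp: l)
    also have "\<dots> = x [^] p \<oplus> y [^] p"
      using x y unfolding mid by (simp add: f_def)
    finally show ?thesis .
  qed
  have "(a \<oplus> b) [^] (p ^ Suc k) = ((a \<oplus> b) [^] (p ^ k)) [^] p"
    using a b by (simp add: nat_pow_pow mult.commute)
  also have "\<dots> = (a [^] (p ^ k)) [^] p \<oplus> (b [^] (p ^ k)) [^] p"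
    unfolding Suc using a b by (intro step) auto
  also have "\<dots> = a [^] (p ^ Suc k) \<oplus> b [^] (p ^ Suc k)"
    using a b by (simp add: nat_pow_pow mult.commute)
  finally show ?case .
qed

text \<open>Additivity applied to \<open>(a - b) + b\<close> avoids any computation with the sign
  \<open>(-1) ^ (p ^ k)\<close>.\<close>

lemma (in cring) frobenius_minus:
  fixes p k :: nat
  assumes p: "prime p" and char: "[p] \<cdot> \<one> = \<zero>" and a: "a \<in> carrier R" and b: "b \<in> carrier R"
  shows "(a \<ominus> b) [^] (p ^ k) = a [^] (p ^ k) \<ominus> b [^] (p ^ k)"
proof -
  have "a [^] (p ^ k) = (a \<ominus> b \<oplus> b) [^] (p ^ k)"
    using a b by (simp add: minus_eq a_assoc l_neg)
  also have "\<dots> = (a \<ominus> b) [^] (p ^ k) \<oplus> b [^] (p ^ k)"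
    using a b by (intro frobenius_add[OF p char]) auto
  finally show ?thesis
    using a b by (simp add: minus_eq a_assoc r_neg)
qed

lemma (in ring_hom_ring) hom_add_pow:
  fixes n :: nat
  assumes "x \<in> carrier R"
  shows "h ([n] \<cdot>\<^bsub>R\<^esub> x) = [n] \<cdot>\<^bsub>S\<^esub> h x"
  using assms by (induction n) (simp_all add: R.add.nat_pow_Suc S.add.nat_pow_Suc)

text \<open>The fixed points are the roots of \<open>X ^ q - X\<close> with
  \<open>q = p ^ m\<close>. Over an algebraically closed field this polynomial has \<open>q\<close>
  roots counted with multiplicity, and all of them are simple.\<close>

lemma (in algebraically_closed) card_frobenius_fixed_points:
  fixes p m :: nat
  assumes p: "prime p" and char: "[p] \<cdot> \<one> = \<zero>" and m: "m > 0"
  shows "card {x \<in> carrier L. x [^] (p ^ m) = x} = p ^ m"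
proof -
  define q where "q = p ^ m"
  have q: "q > 1" unfolding q_def using prime_gt_1_nat[OF p] m by (rule one_less_power)
  let ?P = "poly_ring L"
  interpret UP: domain ?P
    using univ_poly_is_domain[OF carrier_is_subring] .
  have X: "X \<in> carrier ?P" by (rule var_closed(1)[OF carrier_is_subring])
  interpret C: ring_hom_ring L ?P poly_of_const
    using canonical_embedding_ring_hom[OF carrier_is_subring] by simp
  define f where "f = X [^]\<^bsub>?P\<^esub> q \<ominus>\<^bsub>?P\<^esub> X"
  have f: "f \<in> carrier ?P" unfolding f_def using X by simp
  have fr: "ring_hom_ring ?P L (\<lambda>g. eval g r)" if "r \<in> carrier L" for r
    using eval_ring_hom[OF carrier_is_subring that] .
  have evf: "eval f r = r [^] q \<ominus> r" if r: "r \<in> carrier L" for r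
  proof -
    interpret E: ring_hom_ring ?P L "\<lambda>g. eval g r" using fr[OF r] .
    show ?thesis
      unfolding f_def UP.minus_eq minus_eq using X r
      by (simp add: E.hom_nat_pow eval_var)
  qed
  \<comment> \<open>Since \<open>q > 1\<close>, the leading term of \<open>X ^ q\<close> survives
    the subtraction of \<open>X\<close>.\<close>
  have "degree (X [^]\<^bsub>?P\<^esub> q) = q"
    using polynomial_pow_degree[OF X, of q] by (simp add: var_def)
  moreover have "degree (\<ominus>\<^bsub>?P\<^esub> X) = 1"
    using univ_poly_a_inv_degree[OF carrier_is_subring X] by (simp add: var_def)
  ultimately have deg: "degree f = q"
    unfolding f_def UP.minus_eq univ_poly_add
    using poly_add_degree_eq[OF carrier_is_subring, of "X [^]\<^bsub>?P\<^esub> q" "\<ominus>\<^bsub>?P\<^esub> X"] X q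
    by (simp add: univ_poly_carrier)
  then have f0: "f \<noteq> []" using q by auto
  \<comment> \<open>The constants carry the characteristic into the polynomial ring, so that
    Frobenius is available there.\<close>
  have charP: "[p] \<cdot>\<^bsub>?P\<^esub> \<one>\<^bsub>?P\<^esub> = \<zero>\<^bsub>?P\<^esub>"
    using C.hom_add_pow[of \<one> p] char by simp
  \<comment> \<open>With \<open>Y = X - r\<close>, Frobenius gives \<open>f = Y ^ q - Y\<close>, so \<open>Y\<^sup>2\<close> dividing \<open>f\<close> would make \<open>Y\<close> divide
    \<open>Y ^ (q - 1) - 1\<close>, which is nonzero at \<open>r\<close>.\<close>
  have simple: "alg_mult f r \<le> 1" if r: "r \<in> carrier L" and root: "r [^] q = r" for r
  proof (rule ccontr)
    assume "\<not> alg_mult f r \<le> 1"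
    then have two: "2 \<le> alg_mult f r" by simp
    define Y where "Y = [\<one>, \<ominus> r]"
    define C where "C = poly_of_const r"
    interpret E: ring_hom_ring ?P L "\<lambda>g. eval g r" using fr[OF r] .
    have C: "C \<in> carrier ?P" unfolding C_def using r by simp
    have Cq: "C [^]\<^bsub>?P\<^esub> q = C" unfolding C_def using C.hom_nat_pow[OF r, of q] root by simp
    have YXC: "Y = X \<ominus>\<^bsub>?P\<^esub> C"
    proof -
      have "X \<ominus>\<^bsub>?P\<^esub> C = poly_add [\<one>, \<zero>] (poly_of_const (\<ominus> r))"
        unfolding UP.minus_eq C_def univ_poly_add var_def using C.hom_a_inv[OF r] by simp
      also have "\<dots> = Y"
        unfolding Y_def poly_of_const_def using r by simp
      finally show ?thesis ..
    qed
    have Y: "Y \<in> carrier ?P" unfolding YXC using X C by simp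
    have "(Y [^]\<^bsub>?P\<^esub> (2::nat)) pdivides f"
      unfolding Y_def using le_alg_mult_imp_pdivides[OF r f two] .
    then obtain Z where Z: "Z \<in> carrier ?P" and fZ: "f = Y [^]\<^bsub>?P\<^esub> (2::nat) \<otimes>\<^bsub>?P\<^esub> Z"
      unfolding pdivides_def by auto
    have "Y [^]\<^bsub>?P\<^esub> q = X [^]\<^bsub>?P\<^esub> q \<ominus>\<^bsub>?P\<^esub> C"
      unfolding YXC q_def using UP.frobenius_minus[OF p charP X C, of m] Cq by (simp add: q_def)
    moreover have "A \<ominus>\<^bsub>?P\<^esub> X = (A \<ominus>\<^bsub>?P\<^esub> C) \<ominus>\<^bsub>?P\<^esub> (X \<ominus>\<^bsub>?P\<^esub> C)" if "A \<in> carrier ?P" for A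
      using that X C by (simp add: UP.minus_eq UP.minus_add UP.a_ac UP.r_neg2)
    ultimately have "f = Y [^]\<^bsub>?P\<^esub> q \<ominus>\<^bsub>?P\<^esub> Y"
      unfolding f_def YXC[symmetric] using X by simp
    also have "Y [^]\<^bsub>?P\<^esub> q = Y \<otimes>\<^bsub>?P\<^esub> Y [^]\<^bsub>?P\<^esub> (q - 1)"
      using UP.nat_pow_Suc2[OF Y, of "q - 1"] q by simp
    finally have "Y \<otimes>\<^bsub>?P\<^esub> (Y \<otimes>\<^bsub>?P\<^esub> Z) = Y \<otimes>\<^bsub>?P\<^esub> (Y [^]\<^bsub>?P\<^esub> (q - 1) \<ominus>\<^bsub>?P\<^esub> \<one>\<^bsub>?P\<^esub>)"
      using Y Z fZ by (simp add: UP.minus_eq UP.r_distr UP.r_minus numeral_2_eq_2 UP.m_assoc)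
    moreover have ev: "eval Y r = \<zero>" unfolding Y_def using r by (simp add: r_neg)
    then have "Y \<noteq> \<zero>\<^bsub>?P\<^esub>" unfolding Y_def univ_poly_zero by simp
    ultimately have "Y \<otimes>\<^bsub>?P\<^esub> Z = Y [^]\<^bsub>?P\<^esub> (q - 1) \<ominus>\<^bsub>?P\<^esub> \<one>\<^bsub>?P\<^esub>"
      using Y Z UP.m_lcancel by auto
    then have "eval (Y \<otimes>\<^bsub>?P\<^esub> Z) r = eval (Y [^]\<^bsub>?P\<^esub> (q - 1) \<ominus>\<^bsub>?P\<^esub> \<one>\<^bsub>?P\<^esub>) r" by simp
    then have "\<zero> = \<zero> [^] (q - 1) \<ominus> \<one>"
      using Y Z r ev unfolding UP.minus_eq minus_eq by (simp add: E.hom_nat_pow del: eval.simps)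
    \<comment> \<open>As \<open>q - 1 > 0\<close>, this power vanishes and evaluation at
      \<open>r\<close> leaves \<open>0 = -1\<close>.\<close>
    moreover have "\<zero> [^] (q - 1) = \<zero>" using q by (simp add: nat_pow_zero)
    ultimately show False by (metis a_minus_def l_zero local.minus_minus minus_zero one_closed a_inv_closed one_not_zero)
  qed
  have roots_eq: "set_mset (roots f) = {x \<in> carrier L. x [^] q = x}"
    using roots_mem_iff_is_root[OF f] f0 evf unfolding is_root_def by auto
  have "count (roots f) x = 1" if "x \<in># roots f" for x
  proof -
    have "count (roots f) x > 0" using that by simp
    moreover have "count (roots f) x \<le> 1"
      using that simple[of x] roots_eq alg_mult_eq_count_roots[OF f] by auto
    ultimately show ?thesis by linarith
  qed
  then have "card (set_mset (roots f)) = size (roots f)"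
    by (simp add: size_multiset_overloaded_eq)
  also have "\<dots> = q"
    using roots_over_carrier[OF f] deg unfolding splitted_def by simp
  finally show ?thesis unfolding roots_eq q_def .
qed

text \<open>The field consists of the solutions of \<open>x ^ (p ^ m) = x\<close> in an algebraic
  closure of the prime field; the element type is the one that the construction of this closure from
  \<open>residue_ring (int p)\<close> yields.\<close>

lemma exists_finite_field:
  assumes p: "prime p" and m: "m > 0"
  obtains K :: "((int list \<times> nat) multiset \<Rightarrow> int) ring"
  where "field K" "card (carrier K) = p ^ m" "[p] \<cdot>\<^bsub>K\<^esub> \<one>\<^bsub>K\<^esub> = \<zero>\<^bsub>K\<^esub>"
proof -
  interpret R: residues_prime p "residue_ring (int p)"
    using p by unfold_locales simp_all
  obtain L :: "((int list \<times> nat) multiset \<Rightarrow> int) ring"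
    where L: "algebraic_closure L (R.indexed_const ` carrier (residue_ring (int p)))"
      and h: "R.indexed_const \<in> ring_hom (residue_ring (int p)) L"
    using R.exists_closure .
  interpret L: algebraic_closure L "R.indexed_const ` carrier (residue_ring (int p))" by (rule L)
  interpret h: ring_hom_ring "residue_ring (int p)" L R.indexed_const
    using R.ring_axioms L.ring_axioms h by (rule ring_hom_ringI2)
  \<comment> \<open>At \<open>k = p\<close> this is the vanishing of \<open>p\<close> in the prime
    field, which the embedding transports to \<open>L\<close>.\<close>
  have "[k] \<cdot>\<^bsub>residue_ring (int p)\<^esub> \<one>\<^bsub>residue_ring (int p)\<^esub> = int k mod int p" for k
    by (induction k)
      (simp_all add: R.add.nat_pow_Suc R.res_zero_eq R.res_one_eq R.res_add_eq mod_simps add.commute)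
  then have char: "[p] \<cdot>\<^bsub>L\<^esub> \<one>\<^bsub>L\<^esub> = \<zero>\<^bsub>L\<^esub>"
    using h.hom_add_pow[of "\<one>\<^bsub>residue_ring (int p)\<^esub>" p] R.res_zero_eq h.hom_zero by simp
  let ?F = "{x \<in> carrier L. x [^]\<^bsub>L\<^esub> (p ^ m) = x}"
  have "subfield ?F L"
  proof (intro L.subfieldI' L.subringI)
    \<comment> \<open>Negation is treated as \<open>0 - x\<close>, so that the parity of
      \<open>p\<close> does not matter; \<open>0 ^ (p ^ m) = 0\<close> rests on
      \<open>p > 0\<close>.\<close>
    show "\<ominus>\<^bsub>L\<^esub> x \<in> ?F" if "x \<in> ?F" for x
      using that L.frobenius_minus[OF p char L.zero_closed, of x m] p prime_gt_0_nat[OF p]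
      by (simp add: L.minus_eq L.nat_pow_zero)
    show "inv\<^bsub>L\<^esub> x \<in> ?F" if "x \<in> ?F - {\<zero>\<^bsub>L\<^esub>}" for x
    proof -
      define y where "y = inv\<^bsub>L\<^esub> x"
      have x: "x \<in> carrier L" "x [^]\<^bsub>L\<^esub> (p ^ m) = x" using that by auto
      have "x \<in> Units L" using that L.field_Units by auto
      then have y: "y \<in> carrier L" "y \<otimes>\<^bsub>L\<^esub> x = \<one>\<^bsub>L\<^esub>"
        unfolding y_def by simp_all
      \<comment> \<open>Insert \<open>x y = 1\<close> and replace \<open>x\<close> by its own power
        \<open>x ^ (p ^ m)\<close>; this power then cancels against that of
        \<open>y\<close>.\<close>
      have "y [^]\<^bsub>L\<^esub> (p ^ m) = y [^]\<^bsub>L\<^esub> (p ^ m) \<otimes>\<^bsub>L\<^esub> (x \<otimes>\<^bsub>L\<^esub> y)"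
        using x y L.m_comm by simp
      also have "\<dots> = (y [^]\<^bsub>L\<^esub> (p ^ m) \<otimes>\<^bsub>L\<^esub> x [^]\<^bsub>L\<^esub> (p ^ m)) \<otimes>\<^bsub>L\<^esub> y"
        using x y by (simp add: L.m_assoc)
      also have "\<dots> = (y \<otimes>\<^bsub>L\<^esub> x) [^]\<^bsub>L\<^esub> (p ^ m) \<otimes>\<^bsub>L\<^esub> y"
        by (simp only: L.nat_pow_distrib[OF y(1) x(1)])
      also have "\<dots> = y" using y by simp
      finally show ?thesis using y unfolding y_def by simp
    qed
  qed (auto simp: L.frobenius_add[OF p char] L.nat_pow_distrib)
  then have "field (L\<lparr>carrier := ?F\<rparr>)" by (rule L.subfield_iff(2))
  moreover have "[p] \<cdot>\<^bsub>L\<lparr>carrier := ?F\<rparr>\<^esub> \<one>\<^bsub>L\<lparr>carrier := ?F\<rparr>\<^esub> = \<zero>\<^bsub>L\<lparr>carrier := ?F\<rparr>\<^esub>"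
    using char by (simp add: add_pow_def nat_pow_def)
  ultimately show thesis
    using that L.card_frobenius_fixed_points[OF p char m] by simp
qed

section \<open>Elementary abelian groups and their embeddings\<close>

lemma group_elementary_abelian_group: "group (elementary_abelian_group p n)"
  unfolding elementary_abelian_group_def by simp

lemma carrier_elementary_abelian_group:
  "p > 0 \<Longrightarrow> carrier (elementary_abelian_group p n) = {..<n} \<rightarrow>\<^sub>E {0..<int p}"
  unfolding elementary_abelian_group_def by (simp add: carrier_integer_mod_group)

lemma mult_elementary_abelian_group:
  "x \<otimes>\<^bsub>elementary_abelian_group p n\<^esub> y = (\<lambda>i\<in>{..<n}. (x i + y i) mod int p)"
  unfolding elementary_abelian_group_def by simp

lemma order_elementary_abelian_group: "p > 0 \<Longrightarrow> order (elementary_abelian_group p n) = p ^ n"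
  unfolding order_def by (simp add: carrier_elementary_abelian_group card_PiE)

text \<open>Coordinates in \<open>elementary_abelian_group\<close> add modulo \<open>p\<close>; this
  makes them legitimate exponents in a group of exponent \<open>p\<close>.\<close>

lemma (in group) int_pow_mod_exponent:
  assumes x: "x \<in> carrier G" and exp: "x [^] (p :: nat) = \<one>"
  shows "x [^] (k mod int p) = x [^] k"
proof -
  have "x [^] k = x [^] (int p * (k div int p) + k mod int p)" by simp
  also have "\<dots> = (x [^] int p) [^] (k div int p) \<otimes> x [^] (k mod int p)"
    using x by (simp only: int_pow_mult int_pow_pow)
  finally show ?thesis using x exp by (simp add: int_pow_int)
qed

text \<open>Induction on the rank: the image of the copy of rank \<open>n\<close> has
  \<open>p ^ n < order G\<close> elements, so some \<open>a\<close> lies outside it, and the powers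
  of \<open>a\<close> carry the additional coordinate.\<close>

lemma (in comm_group) elementary_abelian_group_embedding:
  assumes p: "prime p" and exp: "\<And>x. x \<in> carrier G \<Longrightarrow> x [^] p = \<one>"
    and card: "p ^ n \<le> order G"
  shows "\<exists>h \<in> hom (elementary_abelian_group p n) G. inj_on h (carrier (elementary_abelian_group p n))"
  using card
proof (induction n)
  case 0
  show ?case
    by (rule bexI[of _ "\<lambda>_. \<one>"])
      (auto simp: hom_def elementary_abelian_group_def)
next
  case (Suc n)
  have p0: "p > 0" and p1: "p > 1" using p prime_gt_0_nat prime_gt_1_nat by auto
  let ?E = "elementary_abelian_group p"
  note carrier = carrier_elementary_abelian_group[OF p0]
  have lt: "p ^ n < p ^ Suc n" using p1 p0 by simp
  then have "p ^ n \<le> order G" using Suc.prems by linarith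
  then obtain h where h: "h \<in> hom (?E n) G" and inj: "inj_on h (carrier (?E n))"
    using Suc.IH by auto
  interpret h: group_hom "?E n" G h
    using group_elementary_abelian_group h is_group
    by (simp add: group_hom_def group_hom_axioms_def)
  let ?I = "h ` carrier (?E n)"
  have subI: "subgroup ?I G" by (rule h.img_is_subgroup)
  have "card ?I = p ^ n"
    using card_image[OF inj] order_elementary_abelian_group[OF p0] unfolding order_def by simp
  then have "?I \<noteq> carrier G" using lt Suc.prems unfolding order_def by auto
  then obtain a where a: "a \<in> carrier G" "a \<notin> ?I"
    using subgroup.subset[OF subI] by auto
  define r where "r x = restrict x {..<n}" for x :: "nat \<Rightarrow> int"
  define h' where "h' x = h (r x) \<otimes> a [^] (x n)" for x
  have r: "r x \<in> carrier (?E n)" if "x \<in> carrier (?E (Suc n))" for x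
    using that unfolding carrier r_def by (auto simp: PiE_iff)
  have r_mult: "r (x \<otimes>\<^bsub>?E (Suc n)\<^esub> y) = r x \<otimes>\<^bsub>?E n\<^esub> r y" for x y
    unfolding r_def mult_elementary_abelian_group by auto
  have hom: "h' \<in> hom (?E (Suc n)) G"
  proof (rule homI)
    show "h' x \<in> carrier G" if "x \<in> carrier (?E (Suc n))" for x
      using r[OF that] a unfolding h'_def by simp
    fix x y assume x: "x \<in> carrier (?E (Suc n))" and y: "y \<in> carrier (?E (Suc n))"
    have "h' (x \<otimes>\<^bsub>?E (Suc n)\<^esub> y) = h (r x \<otimes>\<^bsub>?E n\<^esub> r y) \<otimes> a [^] ((x n + y n) mod int p)"
      unfolding h'_def r_mult by (simp add: mult_elementary_abelian_group)
    also have "\<dots> = h (r x) \<otimes> h (r y) \<otimes> (a [^] x n \<otimes> a [^] y n)"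
      using r[OF x] r[OF y] a(1) by (simp add: int_pow_mod_exponent exp int_pow_mult)
    also have "\<dots> = h' x \<otimes> h' y"
      using r[OF x] r[OF y] a(1) unfolding h'_def by (simp add: m_ac)
    finally show "h' (x \<otimes>\<^bsub>?E (Suc n)\<^esub> y) = h' x \<otimes> h' y" .
  qed
  interpret h': group_hom "?E (Suc n)" G h'
    using group_elementary_abelian_group hom is_group
    by (simp add: group_hom_def group_hom_axioms_def)
  \<comment> \<open>If \<open>h' x = 1\<close>, then \<open>a [^] (x n)\<close> is the inverse of an
    element of \<open>?I\<close>. Were \<open>x n\<close> prime to \<open>p\<close>, inverting it
    modulo \<open>p\<close> would put \<open>a\<close> itself into \<open>?I\<close>. So
    \<open>x n = 0\<close>, and the injectivity of \<open>h\<close> settles the other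
    coordinates.\<close>
  have "x = \<one>\<^bsub>?E (Suc n)\<^esub>" if x: "x \<in> carrier (?E (Suc n))" and one: "h' x = \<one>" for x
  proof -
    have xn: "0 \<le> x n" "x n < int p" using PiE_mem[OF x[unfolded carrier], of n] by auto
    have "inv (h (r x)) \<in> ?I"
      using r[OF x] subI by (simp add: subgroup.m_inv_closed)
    moreover have "a [^] (x n) \<otimes> h (r x) = \<one>"
      using one r[OF x] a(1) unfolding h'_def by (simp add: m_comm)
    then have "inv (h (r x)) = a [^] (x n)"
      using r[OF x] a(1) by (intro inv_equality) auto
    ultimately have pow: "a [^] (x n) \<in> ?I" by simp
    have xn0: "x n = 0"
    proof (rule ccontr)
      assume "x n \<noteq> 0"
      then have "\<not> int p dvd x n" using xn zdvd_not_zless by auto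
      then have "coprime (x n) (int p)"
        using p by (metis coprime_commute prime_imp_coprime prime_nat_int_transfer)
      then obtain c where "[x n * c = 1] (mod int p)" using cong_solve_coprime_int by auto
      then have "(x n * c) mod int p = 1" using p1 by (simp add: cong_def)
      then have "a = (a [^] (x n)) [^] c"
        using int_pow_mod_exponent[OF a(1) exp[OF a(1)], of "x n * c"] a by (simp add: int_pow_pow)
      then show False using pow subI a by (metis int_pow_closed subgroup_int_pow_closed)
    qed
    then have "h (r x) = \<one>" using one r[OF x] unfolding h'_def by simp
    then have rx: "r x = \<one>\<^bsub>?E n\<^esub>"
      using inj r[OF x] by (simp add: h.inj_on_one_iff)
    have "x i = 0" if "i < n" for i
      using that fun_cong[OF rx, of i] unfolding r_def elementary_abelian_group_def by simp
    then have "x i = 0" if "i < Suc n" for i using that xn0 less_Suc_eq by auto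
    \<comment> \<open>Outside \<open>{..<Suc n}\<close> both sides are \<open>undefined\<close>,
      since members of the carrier are extensional.\<close>
    then show ?thesis
      using x unfolding carrier unfolding elementary_abelian_group_def
      by (auto simp: PiE_iff extensional_def)
  qed
  then have "inj_on h' (carrier (?E (Suc n)))"
    by (intro h'.inj_on_one_iff[THEN iffD2]) auto
  with hom show ?case by blast
qed

section \<open>The lines of the plane over a finite field\<close>

text \<open>The members are the lines through the origin: \<open>V\<close> is the vertical one and
  \<open>D c\<close> the one of slope \<open>c\<close>.\<close>

lemma (in field) spread:
  defines "A \<equiv> add_monoid R \<times>\<times> add_monoid R"
  assumes fin: "finite (carrier R)"
  obtains \<T> where "finite \<T>" "card \<T> \<le> 1 + card (carrier R)" "\<Union>\<T> = carrier A"
    "\<And>S. S \<in> \<T> \<Longrightarrow> subgroup S A \<and> card S = card (carrier R)"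
    "\<And>S T. S \<in> \<T> \<Longrightarrow> T \<in> \<T> \<Longrightarrow> S \<noteq> T \<Longrightarrow> S \<inter> T = {\<one>\<^bsub>A\<^esub>}"
proof -
  define V where "V = {\<zero>} \<times> carrier R"
  define D where "D c = (\<lambda>x. (x, c \<otimes> x)) ` carrier R" for c
  let ?S = "insert V (D ` carrier R)"
  have "group A" unfolding A_def by (intro DirProd_group a_group)
  interpret A: group A by fact
  have invA: "inv\<^bsub>A\<^esub> (x, y) = (\<ominus> x, \<ominus> y)" if "x \<in> carrier R" "y \<in> carrier R" for x y
    using that unfolding A_def by (simp add: inv_DirProd a_group a_inv_def)
  show thesis
  proof (rule that[of ?S])
    show "finite ?S" using fin by simp
    have "card ?S \<le> Suc (card (D ` carrier R))" using fin by (simp add: card_insert_if)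
    then show "card ?S \<le> 1 + card (carrier R)" using card_image_le[OF fin, of D] by simp
    show "\<Union>?S = carrier A"
    proof
      show "\<Union>?S \<subseteq> carrier A" unfolding V_def D_def A_def by auto
      show "carrier A \<subseteq> \<Union>?S"
      proof
        fix z assume "z \<in> carrier A"
        then obtain x y where z: "z = (x, y)" "x \<in> carrier R" "y \<in> carrier R"
          unfolding A_def by auto
        show "z \<in> \<Union>?S"
        proof (cases "x = \<zero>")
          case True
          then show ?thesis using z unfolding V_def by auto
        next
          case False
          \<comment> \<open>A point off the vertical line lies on the line of slope
            \<open>y / x\<close>.\<close>
          then have "x \<in> Units R" using z field_Units by auto
          then have "y = (y \<otimes> inv x) \<otimes> x" "y \<otimes> inv x \<in> carrier R" using z by (simp_all add: m_assoc)
          then show ?thesis using z unfolding D_def by blast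
        qed
      qed
    qed
    show "subgroup S A \<and> card S = card (carrier R)" if S: "S \<in> ?S" for S
    proof -
      consider "S = V" | c where "c \<in> carrier R" "S = D c" using S by auto
      then show ?thesis
      proof cases
        case 1
        have "subgroup V A"
          by (intro A.subgroupI) (auto simp: V_def A_def invA[unfolded A_def])
        then show ?thesis using 1 by (simp add: V_def card_cartesian_product)
      next
        case 2
        have "subgroup (D c) A"
          using 2 by (intro A.subgroupI) (auto simp: D_def A_def invA[unfolded A_def] a_inv_def [symmetric] r_minus r_distr image_iff)
        moreover have "inj_on (\<lambda>x. (x, c \<otimes> x)) (carrier R)" by (auto intro: inj_onI)
        ultimately show ?thesis using 2 by (simp add: D_def card_image)
      qed
    qed
    have VD: "V \<inter> D c = {(\<zero>, \<zero>)}" if "c \<in> carrier R" for c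
      using that unfolding V_def D_def by auto
    have DD: "D c \<inter> D d = {(\<zero>, \<zero>)}" if c: "c \<in> carrier R" and d: "d \<in> carrier R" and "c \<noteq> d" for c d
    proof -
      \<comment> \<open>A nonzero \<open>x\<close> could be cancelled, making the two slopes
        equal.\<close>
      have zero: "x = \<zero>" if "x \<in> carrier R" "c \<otimes> x = d \<otimes> x" for x
        using that c d \<open>c \<noteq> d\<close> m_rcancel by blast
      moreover have "(\<zero>, \<zero>) \<in> D c" "(\<zero>, \<zero>) \<in> D d"
        using c d unfolding D_def by (auto simp: image_iff)
      moreover have "z = (\<zero>, \<zero>)" if z: "z \<in> D c" "z \<in> D d" for z
      proof -
        obtain x where x: "x \<in> carrier R" "z = (x, c \<otimes> x)" using z(1) unfolding D_def by auto
        then have "c \<otimes> x = d \<otimes> x" using z(2) unfolding D_def by auto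
        then have "x = \<zero>" using zero x(1) by blast
        then show ?thesis using x c by simp
      qed
      ultimately show ?thesis by blast
    qed
    show "S \<inter> T = {\<one>\<^bsub>A\<^esub>}" if "S \<in> ?S" "T \<in> ?S" "S \<noteq> T" for S T
    proof -
      have "S = V \<or> (\<exists>c\<in>carrier R. S = D c)" "T = V \<or> (\<exists>c\<in>carrier R. T = D c)"
        using that(1,2) by auto
      then consider "S = V" "T = V" | c where "c \<in> carrier R" "S = V" "T = D c"
        | c where "c \<in> carrier R" "S = D c" "T = V"
        | c d where "c \<in> carrier R" "d \<in> carrier R" "S = D c" "T = D d"
        by blast
      then have "S \<inter> T = {(\<zero>, \<zero>)}"
      proof cases
        case 1
        then show ?thesis using that(3) by simp
      next
        case 2
        then show ?thesis using VD by simp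
      next
        case 3
        then show ?thesis using VD by (simp add: Int_commute)
      next
        case 4
        then show ?thesis using DD[of c d] that(3) by auto
      qed
      then show ?thesis unfolding A_def by simp
    qed
  qed
qed

section \<open>The upper bound and the exact value\<close>

lemma DirProd_nat_pow:
  "(x, y) [^]\<^bsub>G \<times>\<times> H\<^esub> (k :: nat) = (x [^]\<^bsub>G\<^esub> k, y [^]\<^bsub>H\<^esub> k)"
  by (induction k) simp_all

text \<open>\<open>n \<le> 2 * m\<close> gives the plane over the field with \<open>p ^ m\<close>
  elements room for a copy of the group, while \<open>m < n\<close> makes every line too small to
  contain that copy.\<close>

lemma elementary_abelian_group_partition:
  assumes p: "prime p" and mn: "m < n" and nm: "n \<le> 2 * m"
  shows "\<exists>\<H>. group_partition (elementary_abelian_group p n) \<H> \<and> card \<H> \<le> 1 + p ^ m"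
proof -
  have p1: "p > 1" and m: "m > 0" using prime_gt_1_nat[OF p] mn nm by auto
  let ?E = "elementary_abelian_group p n"
  obtain K :: "((int list \<times> nat) multiset \<Rightarrow> int) ring"
    where "field K" and cardK: "card (carrier K) = p ^ m"
      and char: "[p] \<cdot>\<^bsub>K\<^esub> \<one>\<^bsub>K\<^esub> = \<zero>\<^bsub>K\<^esub>"
    using exists_finite_field[OF p m] .
  interpret K: field K by fact
  define A where "A = add_monoid K \<times>\<times> add_monoid K"
  have finK: "finite (carrier K)" using cardK p1 by (intro card_ge_0_finite) simp
  obtain \<S> where fin: "finite \<S>" and card: "card \<S> \<le> 1 + p ^ m" and un: "\<Union>\<S> = carrier A"
    and sub: "\<And>S. S \<in> \<S> \<Longrightarrow> subgroup S A \<and> card S = p ^ m"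
    and triv: "\<And>S T. S \<in> \<S> \<Longrightarrow> T \<in> \<S> \<Longrightarrow> S \<noteq> T \<Longrightarrow> S \<inter> T = {\<one>\<^bsub>A\<^esub>}"
    using K.spread[OF finK] unfolding A_def cardK by metis
  have "group A" unfolding A_def by (intro DirProd_group K.a_group)
  moreover have "z \<otimes>\<^bsub>A\<^esub> w = w \<otimes>\<^bsub>A\<^esub> z" if "z \<in> carrier A" "w \<in> carrier A" for z w
    using that unfolding A_def by (auto simp: K.a_comm)
  ultimately interpret A: comm_group A by (rule group.group_comm_groupI)
  \<comment> \<open>The characteristic becomes the exponent: powers in \<open>add_monoid K\<close>
    are multiples in \<open>K\<close>.\<close>
  have "z [^]\<^bsub>A\<^esub> p = \<one>\<^bsub>A\<^esub>" if "z \<in> carrier A" for z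
    using that K.add_pow_char_eq_zero[OF char _ dvd_refl]
    unfolding A_def by (auto simp: DirProd_nat_pow add_pow_def)
  moreover have "order A = p ^ (2 * m)"
    unfolding order_def A_def by (simp add: card_cartesian_product cardK mult_2 power_add)
  then have "p ^ n \<le> order A" using nm p1 by simp
  ultimately obtain h where h: "h \<in> hom ?E A" and inj: "inj_on h (carrier ?E)"
    using A.elementary_abelian_group_embedding[OF p] by blast
  have "group_partition ?E ((\<lambda>S. h -` S \<inter> carrier ?E) ` \<S>)"
  proof (rule group_partition_vimage[OF group_elementary_abelian_group A.is_group h inj fin _ _ un triv])
    fix S assume S: "S \<in> \<S>"
    show "subgroup S A" using sub[OF S] ..
    show "finite S \<and> card S < order ?E"
      using sub[OF S] p1 mn by (auto simp: order_elementary_abelian_group intro: card_ge_0_finite)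
  qed
  moreover have "card ((\<lambda>S. h -` S \<inter> carrier ?E) ` \<S>) \<le> 1 + p ^ m"
    using card_image_le[OF fin] card by (rule order_trans)
  ultimately show ?thesis by blast
qed

theorem proposition2:
  fixes p n :: nat
  assumes "prime p" and "n > 1"
  shows "rho (elementary_abelian_group p n) = 1 + p ^ nat \<lceil>real n / 2\<rceil>"
proof -
  let ?E = "elementary_abelian_group p n"
  define m where "m = (n + 1) div 2"
  have ceil: "nat \<lceil>real n / 2\<rceil> = m"
    unfolding m_def by linarith
  \<comment> \<open>\<open>m < n\<close> rests on \<open>n > 1\<close>; for \<open>n = 1\<close> one
    would have \<open>m = n\<close>.\<close>
  have "m < n" "n \<le> 2 * m" using assms(2) unfolding m_def by auto
  then obtain \<H> where part: "group_partition ?E \<H>" and card: "card \<H> \<le> 1 + p ^ m"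
    using elementary_abelian_group_partition[OF assms(1)] by blast
  have ge: "1 + p ^ m \<le> card \<K>" if "group_partition ?E \<K>" for \<K>
    unfolding m_def
    using group.group_partition_card_ge[OF group_elementary_abelian_group that _ assms(1)]
      order_elementary_abelian_group assms prime_gt_0_nat by auto
  have "card \<H> = 1 + p ^ m" using card ge[OF part] by simp
  \<comment> \<open>The value is attained at \<open>\<H>\<close> and is a lower bound for all sizes,
    so the infimum is a minimum.\<close>
  then have "Inf {card \<H> |\<H>. group_partition ?E \<H>} = 1 + p ^ m"
    using part ge by (intro cInf_eq_minimum) (auto, metis)
  then show ?thesis unfolding rho_def ceil .
qed

end
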